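(* Let $A$ and $B$ be two nontrivial, finitely generated, orderable groups, and let $G = A*B$ be their free product. There exists no order $\leq$ on $G$ such that its positive cone $G_+$ is represented by a regular language. That is, for every order $\leq$ on $G$, every finite alphabet $X$, every monoid homomorphism $\phi : X^* \to G$, and every language $L \subseteq X^*$ with $\phi(L) = G_+$, the language $L$ is not regular.
   Context: An order on a group $G$ means a total left order: a total order $\leq$ on $G$ such that $g \leq g'$ implies $hg \leq hg'$ for all $g, g', h \in G$. A group is orderable if it admits an order. The positive cone of an ordered group $(G,\leq)$ is $G_+ = \{g \in G \mid e < g\}$, where $e$ is the identity element of $G$. For a finite set $X$, $X^*$ denotes the free monoid on $X$; a language over $X$ is a subset of $X^*$. A language is regular if it is accepted by a finite state automaton. Given a monoid homomorphism $\phi: X^* \to G$, a language $L \subseteq X^*$ represents a subset $S \subseteq G$ if $\phi(L) = S$. *)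

theory Defs
  imports "HOL-Algebra.Elementary_Groups" "HOL-Algebra.Generated_Groups"
begin

section \<open>Ordered groups\<close>

definition left_order :: "('a, 'm) monoid_scheme \<Rightarrow> 'a rel \<Rightarrow> bool" where
  "left_order G r \<longleftrightarrow> linear_order_on (carrier G) r \<and>
     (\<forall>g \<in> carrier G. \<forall>g' \<in> carrier G. \<forall>h \<in> carrier G.
        (g, g') \<in> r \<longrightarrow> (h \<otimes>\<^bsub>G\<^esub> g, h \<otimes>\<^bsub>G\<^esub> g') \<in> r)"

definition orderable :: "('a, 'm) monoid_scheme \<Rightarrow> bool" where
  "orderable G \<longleftrightarrow> (\<exists>r. left_order G r)"

definition positive_cone :: "('a, 'm) monoid_scheme \<Rightarrow> 'a rel \<Rightarrow> 'a set" where
  "positive_cone G r = {g \<in> carrier G. (\<one>\<^bsub>G\<^esub>, g) \<in> r \<and> g \<noteq> \<one>\<^bsub>G\<^esub>}"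

definition finitely_generated :: "('a, 'm) monoid_scheme \<Rightarrow> bool" where
  "finitely_generated G \<longleftrightarrow> (\<exists>S. finite S \<and> S \<subseteq> carrier G \<and> generate G S = carrier G)"


section \<open>Regular languages\<close>

definition free_monoid :: "'x set \<Rightarrow> 'x list monoid" where
  "free_monoid X = \<lparr>carrier = lists X, mult = (@), one = []\<rparr>"

record ('s, 'x) fsa =
  states :: "'s set"
  trans :: "'s \<Rightarrow> 'x \<Rightarrow> 's"
  init :: 's
  final :: "'s set"

definition finite_automaton :: "'x set \<Rightarrow> ('s, 'x) fsa \<Rightarrow> bool" where
  "finite_automaton X M \<longleftrightarrow> finite (states M) \<and> init M \<in> states M \<and> final M \<subseteq> states M \<and>
     (\<forall>q \<in> states M. \<forall>x \<in> X. trans M q x \<in> states M)"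

definition accepted_language :: "'x set \<Rightarrow> ('s, 'x) fsa \<Rightarrow> 'x list set" where
  "accepted_language X M = {w \<in> lists X. foldl (trans M) (init M) w \<in> final M}"

text \<open>Taking states in \<^typ>\<open>nat\<close> is no restriction, since every finite set of states
  can be renumbered.\<close>

definition regular_language :: "'x set \<Rightarrow> 'x list set \<Rightarrow> bool" where
  "regular_language X L \<longleftrightarrow>
     (\<exists>M :: (nat, 'x) fsa. finite_automaton X M \<and> accepted_language X M = L)"


section \<open>Free products\<close>

text \<open>The free product of two groups, realised on reduced words: lists of nontrivial elements
  taken alternately from the two factors. The product of two words is obtained by letting the
  letters of the first one act on the second one, merging adjacent letters from the same factor
  and dropping the letters that become trivial. The lemmas below show that this is a group and
  that it has the universal property of the coproduct.\<close>

definition fp_left :: "('a, 'm) monoid_scheme \<Rightarrow> 'a \<Rightarrow> ('a + 'b) list \<Rightarrow> ('a + 'b) list" where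
  "fp_left A a w = (if a = \<one>\<^bsub>A\<^esub> then w else Inl a # w)"

definition fp_right :: "('b, 'n) monoid_scheme \<Rightarrow> 'b \<Rightarrow> ('a + 'b) list \<Rightarrow> ('a + 'b) list" where
  "fp_right B b w = (if b = \<one>\<^bsub>B\<^esub> then w else Inr b # w)"

fun fp_cons :: "('a, 'm) monoid_scheme \<Rightarrow> ('b, 'n) monoid_scheme \<Rightarrow> 'a + 'b
    \<Rightarrow> ('a + 'b) list \<Rightarrow> ('a + 'b) list" where
  "fp_cons A B (Inl a) (Inl a' # w) = fp_left A (a \<otimes>\<^bsub>A\<^esub> a') w"
| "fp_cons A B (Inr b) (Inr b' # w) = fp_right B (b \<otimes>\<^bsub>B\<^esub> b') w"
| "fp_cons A B (Inl a) w = fp_left A a w"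
| "fp_cons A B (Inr b) w = fp_right B b w"

definition reduced_words ::
  "('a, 'm) monoid_scheme \<Rightarrow> ('b, 'n) monoid_scheme \<Rightarrow> ('a + 'b) list set" where
  "reduced_words A B =
     {w \<in> lists ((carrier A - {\<one>\<^bsub>A\<^esub>}) <+> (carrier B - {\<one>\<^bsub>B\<^esub>})). distinct_adj (map isl w)}"

definition free_product ::
  "('a, 'm) monoid_scheme \<Rightarrow> ('b, 'n) monoid_scheme \<Rightarrow> ('a + 'b) list monoid" where
  "free_product A B =
     \<lparr>carrier = reduced_words A B, mult = (\<lambda>u v. foldr (fp_cons A B) u v), one = []\<rparr>"

context
  fixes A :: "('a, 'm) monoid_scheme" and B :: "('b, 'n) monoid_scheme"
  assumes A: "group A" and B: "group B"
begin

interpretation A: group A by (fact A)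
interpretation B: group B by (fact B)

lemma reduced_words_Nil: "[] \<in> reduced_words A B"
  by (simp add: reduced_words_def)

lemma reduced_words_Inl:
  "Inl a # w \<in> reduced_words A B \<longleftrightarrow> a \<in> carrier A \<and> a \<noteq> \<one>\<^bsub>A\<^esub> \<and> w \<in> reduced_words A B \<and>
     (\<forall>a' v. w \<noteq> Inl a' # v)"
  by (cases w) (auto simp: reduced_words_def isl_def distinct_adj_Cons)

lemma reduced_words_Inr:
  "Inr b # w \<in> reduced_words A B \<longleftrightarrow> b \<in> carrier B \<and> b \<noteq> \<one>\<^bsub>B\<^esub> \<and> w \<in> reduced_words A B \<and>
     (\<forall>b' v. w \<noteq> Inr b' # v)"
  by (cases w; cases "hd w") (auto simp: reduced_words_def isl_def distinct_adj_Cons)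

lemmas fp_simps = reduced_words_Nil reduced_words_Inl reduced_words_Inr fp_left_def fp_right_def

lemma fp_cons_closed:
  assumes "s \<in> carrier A <+> carrier B" "w \<in> reduced_words A B"
  shows "fp_cons A B s w \<in> reduced_words A B"
  using assms by (cases "(A, B, s, w)" rule: fp_cons.cases) (auto simp: fp_simps)

lemma fp_cons_Inl_Inl:
  assumes "a \<in> carrier A" "a' \<in> carrier A" "w \<in> reduced_words A B"
  shows "fp_cons A B (Inl a) (fp_cons A B (Inl a') w) = fp_cons A B (Inl (a \<otimes>\<^bsub>A\<^esub> a')) w"
proof (cases w)
  case Nil
  then show ?thesis using assms by (auto simp: fp_simps)
next
  case (Cons s v)
  show ?thesis
  proof (cases s)
    case (Inl c)
    then have c: "c \<in> carrier A" and v: "v \<in> reduced_words A B" "\<And>d u. v \<noteq> Inl d # u"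
      using Cons assms(3) by (auto simp: fp_simps)
    have "fp_cons A B (Inl x) v = fp_left A x v" for x
      using v(2) by (cases v; cases "hd v") auto
    then show ?thesis
      using Cons Inl assms(1,2) c by (auto simp: fp_left_def A.m_assoc)
  qed (use Cons assms in \<open>auto simp: fp_simps\<close>)
qed

lemma fp_cons_Inr_Inr:
  assumes "b \<in> carrier B" "b' \<in> carrier B" "w \<in> reduced_words A B"
  shows "fp_cons A B (Inr b) (fp_cons A B (Inr b') w) = fp_cons A B (Inr (b \<otimes>\<^bsub>B\<^esub> b')) w"
proof (cases w)
  case Nil
  then show ?thesis using assms by (auto simp: fp_simps)
next
  case (Cons s v)
  show ?thesis
  proof (cases s)
    case (Inr c)
    then have c: "c \<in> carrier B" and v: "v \<in> reduced_words A B" "\<And>d u. v \<noteq> Inr d # u"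
      using Cons assms(3) by (auto simp: fp_simps)
    have "fp_cons A B (Inr x) v = fp_right B x v" for x
      using v(2) by (cases v; cases "hd v") auto
    then show ?thesis
      using Cons Inr assms(1,2) c by (auto simp: fp_right_def B.m_assoc)
  qed (use Cons assms in \<open>auto simp: fp_simps\<close>)
qed

lemma fp_cons_one:
  assumes "w \<in> reduced_words A B"
  shows "fp_cons A B (Inl \<one>\<^bsub>A\<^esub>) w = w" "fp_cons A B (Inr \<one>\<^bsub>B\<^esub>) w = w"
  using assms by (cases w; cases "hd w"; auto simp: fp_simps)+

lemma reduced_words_ConsD:
  assumes "s # w \<in> reduced_words A B"
  shows "s \<in> carrier A <+> carrier B" "w \<in> reduced_words A B" "fp_cons A B s w = s # w"
  using assms by (cases s; cases w; cases "hd w"; force simp: fp_simps)+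

lemma foldr_fp_cons_closed:
  assumes "u \<in> reduced_words A B" "v \<in> reduced_words A B"
  shows "foldr (fp_cons A B) u v \<in> reduced_words A B"
  using assms(1)
proof (induction u)
  case (Cons s u)
  then show ?case
    using fp_cons_closed[OF reduced_words_ConsD(1)] reduced_words_ConsD(2) by simp
qed (simp add: assms(2))

lemma foldr_fp_cons_Nil:
  assumes "u \<in> reduced_words A B"
  shows "foldr (fp_cons A B) u [] = u"
  using assms
proof (induction u)
  case (Cons s u)
  then show ?case using reduced_words_ConsD(2,3) by simp
qed simp

lemma foldr_fp_cons_cons:
  assumes "s \<in> carrier A <+> carrier B" "v \<in> reduced_words A B" "w \<in> reduced_words A B"
  shows "foldr (fp_cons A B) (fp_cons A B s v) w = fp_cons A B s (foldr (fp_cons A B) v w)"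
proof -
  have tl: "foldr (fp_cons A B) u w \<in> reduced_words A B" if "u \<in> reduced_words A B" for u
    using that assms(3) by (rule foldr_fp_cons_closed)
  have l: "foldr (fp_cons A B) (fp_left A a u) w = fp_cons A B (Inl a) (foldr (fp_cons A B) u w)"
    if "u \<in> reduced_words A B" for a u
    using tl[OF that] by (auto simp: fp_left_def fp_cons_one)
  have r: "foldr (fp_cons A B) (fp_right B b u) w = fp_cons A B (Inr b) (foldr (fp_cons A B) u w)"
    if "u \<in> reduced_words A B" for b u
    using tl[OF that] by (auto simp: fp_right_def fp_cons_one)
  show ?thesis
    using assms(1,2)
    by (cases "(A, B, s, v)" rule: fp_cons.cases)
       (auto simp: l r fp_cons_Inl_Inl fp_cons_Inr_Inr tl reduced_words_Nil
                   reduced_words_Inl reduced_words_Inr)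
qed

lemma foldr_fp_cons_assoc:
  assumes "u \<in> reduced_words A B" "v \<in> reduced_words A B" "w \<in> reduced_words A B"
  shows "foldr (fp_cons A B) (foldr (fp_cons A B) u v) w =
         foldr (fp_cons A B) u (foldr (fp_cons A B) v w)"
  using assms(1)
proof (induction u)
  case (Cons s u)
  note su = reduced_words_ConsD[OF Cons.prems]
  show ?case
    using Cons.IH[OF su(2)]
      foldr_fp_cons_cons[OF su(1) foldr_fp_cons_closed[OF su(2) assms(2)] assms(3)]
    by simp
qed simp

lemma fp_cons_inverse:
  assumes "s \<in> carrier A <+> carrier B"
  obtains t where "t \<in> carrier A <+> carrier B"
    "\<And>w. w \<in> reduced_words A B \<Longrightarrow> fp_cons A B t (fp_cons A B s w) = w"
proof (cases s)
  case (Inl a)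
  with assms show ?thesis
    by (intro that[of "Inl (inv\<^bsub>A\<^esub> a)"]) (auto simp: fp_cons_Inl_Inl fp_cons_one)
next
  case (Inr b)
  with assms show ?thesis
    by (intro that[of "Inr (inv\<^bsub>B\<^esub> b)"]) (auto simp: fp_cons_Inr_Inr fp_cons_one)
qed

lemma foldr_fp_cons_inverse:
  assumes "u \<in> reduced_words A B"
  shows "\<exists>v \<in> reduced_words A B. foldr (fp_cons A B) v u = []"
  using assms
proof (induction u)
  case Nil
  then show ?case by (auto intro: bexI[of _ "[]"] simp: reduced_words_Nil)
next
  case (Cons s u)
  note su = reduced_words_ConsD[OF Cons.prems]
  obtain v where v: "v \<in> reduced_words A B" "foldr (fp_cons A B) v u = []"
    using Cons.IH su(2) by auto
  obtain t where t: "t \<in> carrier A <+> carrier B"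
    "\<And>w. w \<in> reduced_words A B \<Longrightarrow> fp_cons A B t (fp_cons A B s w) = w"
    using fp_cons_inverse[OF su(1)] by blast
  have t': "fp_cons A B t [] \<in> reduced_words A B"
    using t(1) reduced_words_Nil by (rule fp_cons_closed)
  have "foldr (fp_cons A B) (fp_cons A B t []) (s # u) = u"
    using foldr_fp_cons_cons[OF t(1) reduced_words_Nil Cons.prems] t(2)[OF su(2)] su(3) by simp
  then have "foldr (fp_cons A B) (foldr (fp_cons A B) v (fp_cons A B t [])) (s # u) = []"
    using foldr_fp_cons_assoc[OF v(1) t' Cons.prems] v(2) by simp
  then show ?case
    using foldr_fp_cons_closed[OF v(1) t'] by blast
qed

lemma group_free_product: "group (free_product A B)"
  by (rule groupI)
     (auto simp: free_product_def foldr_fp_cons_closed foldr_fp_cons_assoc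
        foldr_fp_cons_inverse reduced_words_Nil)

lemma fp_left_hom: "(\<lambda>a. fp_left A a []) \<in> hom A (free_product A B)"
  by (rule homI) (auto simp: free_product_def fp_simps)

lemma fp_right_hom: "(\<lambda>b. fp_right B b []) \<in> hom B (free_product A B)"
  by (rule homI) (auto simp: free_product_def fp_simps)

lemma free_product_universal:
  assumes H: "group H" and f: "f \<in> hom A H" and g: "g \<in> hom B H"
  shows "\<exists>h \<in> hom (free_product A B) H.
           (\<forall>a \<in> carrier A. h (fp_left A a []) = f a) \<and>
           (\<forall>b \<in> carrier B. h (fp_right B b []) = g b)"
proof -
  interpret H: group H by (fact H)
  interpret f: group_hom A H f by unfold_locales (fact f)
  interpret g: group_hom B H g by unfold_locales (fact g)
  define k where "k s = (case s of Inl a \<Rightarrow> f a | Inr b \<Rightarrow> g b)" for s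
  define h where "h w = foldr (\<lambda>s x. k s \<otimes>\<^bsub>H\<^esub> x) w \<one>\<^bsub>H\<^esub>" for w
  have k: "k s \<in> carrier H" if "s \<in> carrier A <+> carrier B" for s
    using that by (auto simp: k_def)
  have hc: "h w \<in> carrier H" if "w \<in> reduced_words A B" for w
    using that
  proof (induction w)
    case (Cons s w)
    then show ?case
      using k[OF reduced_words_ConsD(1)[OF Cons.prems]] reduced_words_ConsD(2)
      by (simp add: h_def)
  qed (simp add: h_def)
  have hcons: "h (fp_cons A B s w) = k s \<otimes>\<^bsub>H\<^esub> h w"
    if "s \<in> carrier A <+> carrier B" "w \<in> reduced_words A B" for s w
  proof -
    have l: "h (fp_left A a u) = f a \<otimes>\<^bsub>H\<^esub> h u" if "u \<in> reduced_words A B" for a u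
      using hc[OF that] by (auto simp: fp_left_def h_def k_def)
    have r: "h (fp_right B b u) = g b \<otimes>\<^bsub>H\<^esub> h u" if "u \<in> reduced_words A B" for b u
      using hc[OF that] by (auto simp: fp_right_def h_def k_def)
    have c: "h (t # u) = k t \<otimes>\<^bsub>H\<^esub> h u" for t u by (simp add: h_def)
    show ?thesis
      using that
      by (cases "(A, B, s, w)" rule: fp_cons.cases)
         (auto simp: l r c hc k_def reduced_words_Nil reduced_words_Inl reduced_words_Inr H.m_assoc)
  qed
  have "h (foldr (fp_cons A B) u v) = h u \<otimes>\<^bsub>H\<^esub> h v"
    if "u \<in> reduced_words A B" "v \<in> reduced_words A B" for u v
    using that(1)
  proof (induction u)
    case Nil
    then show ?case using hc[OF that(2)] by (simp add: h_def)
  next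
    case (Cons s u)
    note su = reduced_words_ConsD[OF Cons.prems]
    have "h (foldr (fp_cons A B) (s # u) v) = k s \<otimes>\<^bsub>H\<^esub> (h u \<otimes>\<^bsub>H\<^esub> h v)"
      using hcons[OF su(1) foldr_fp_cons_closed[OF su(2) that(2)]] Cons.IH su(2) by simp
    also have "\<dots> = h (s # u) \<otimes>\<^bsub>H\<^esub> h v"
      using hcons[OF su(1,2)] k[OF su(1)] hc[OF su(2)] hc[OF that(2)] su(3)
      by (simp add: H.m_assoc)
    finally show ?case .
  qed
  then have "h \<in> hom (free_product A B) H"
    by (intro homI) (auto simp: free_product_def hc)
  moreover have "h (fp_left A a []) = f a" if "a \<in> carrier A" for a
    using that by (auto simp: fp_left_def h_def k_def)
  moreover have "h (fp_right B b []) = g b" if "b \<in> carrier B" for b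
    using that by (auto simp: fp_right_def h_def k_def)
  ultimately show ?thesis by blast
qed

lemma free_product_universal_unique:
  assumes H: "group H" and h: "h \<in> hom (free_product A B) H" "h' \<in> hom (free_product A B) H"
    and "\<And>a. a \<in> carrier A \<Longrightarrow> h (fp_left A a []) = h' (fp_left A a [])"
    and "\<And>b. b \<in> carrier B \<Longrightarrow> h (fp_right B b []) = h' (fp_right B b [])"
    and w: "w \<in> carrier (free_product A B)"
  shows "h w = h' w"
proof -
  have "w \<in> reduced_words A B" using w by (simp add: free_product_def)
  then show ?thesis
  proof (induction w)
    case Nil
    have "h \<one>\<^bsub>free_product A B\<^esub> = h' \<one>\<^bsub>free_product A B\<^esub>"
      using h by (simp add: hom_one[OF _ group_free_product H])
    then show ?case by (simp add: free_product_def)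
  next
    case (Cons s w)
    note sw = reduced_words_ConsD[OF Cons.prems]
    have s: "[s] \<in> reduced_words A B" "h [s] = h' [s]"
      using Cons.prems assms(4,5) by (cases s; force simp: fp_simps)+
    have "s # w = [s] \<otimes>\<^bsub>free_product A B\<^esub> w"
      using sw(3) by (simp add: free_product_def)
    moreover have "[s] \<in> carrier (free_product A B)" "w \<in> carrier (free_product A B)"
      using s sw(2) by (auto simp: free_product_def)
    ultimately show ?case
      using hom_mult[OF h(1)] hom_mult[OF h(2)] Cons.IH[OF sw(2)] s(2) by simp
  qed
qed

end

end

theory Submission
  imports Defs "HOL-Library.Sublist"
begin

text \<open>
  If a regular language represents the positive cone, then every prefix \<open>u\<close> of a positive word can
  be completed to a positive word by one of finitely many words \<open>w\<close>, at most one for each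
  state of the automaton; so \<open>\<phi> u\<close> times one of finitely many elements is positive
  (\<open>regular_finite_completions\<close>). On the other hand the Cayley graph of a free product is tree-like:
  a word representing a reduced product \<open>h @ k\<close> with \<open>k \<noteq> []\<close> has to pass through \<open>h\<close>, up to a
  piece of the image of a single letter (\<open>word_passes_through_prefix\<close>). Together, these two facts
  give a finite set \<open>F\<close>, independent of \<open>h\<close>, such that \<open>h \<otimes> f\<close> is positive for some \<open>f \<in> F\<close>, in
  other words \<open>inv h < f\<close>, whenever \<open>h\<close> is a proper prefix of the reduced form of a positive element.

  But there are such prefixes with \<open>inv h\<close> arbitrarily large. Take any nontrivial upper bound \<open>x\<close>
  of \<open>F\<close>, and a nontrivial letter \<open>s\<close> from the factor to which the first letter of \<open>x\<close> does not
  belong. The conjugate of \<open>s\<close> by \<open>x\<close> has the reduced form \<open>inv x @ s # x\<close>, and after replacing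
  \<open>s\<close> by its inverse if necessary, it is positive. Its prefix \<open>h = inv x\<close> gives \<open>x < f\<close> for some
  \<open>f \<in> F\<close>, a contradiction.
\<close>

section \<open>Left orders\<close>

lemma left_orderD:
  assumes "left_order G r"
  shows "refl_on (carrier G) r" "Relation.trans r" "antisym r" "total_on (carrier G) r"
    "\<And>g g' h. \<lbrakk>g \<in> carrier G; g' \<in> carrier G; h \<in> carrier G; (g, g') \<in> r\<rbrakk>
      \<Longrightarrow> (h \<otimes>\<^bsub>G\<^esub> g, h \<otimes>\<^bsub>G\<^esub> g') \<in> r"
  using assms
  by (auto simp: left_order_def linear_order_on_def partial_order_on_def preorder_on_def)

lemma left_order_finite_upper_bound:
  assumes "group G" "left_order G r" "finite F" "F \<subseteq> carrier G"
  shows "\<exists>x \<in> carrier G. \<forall>f \<in> F. (f, x) \<in> r"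
  using assms(3,4)
proof (induction F)
  case empty
  interpret group G by (fact assms(1))
  show ?case by auto
next
  case (insert g F)
  then obtain x where x: "x \<in> carrier G" "\<forall>f \<in> F. (f, x) \<in> r" by auto
  have g: "g \<in> carrier G" using insert.prems by auto
  note o = left_orderD[OF assms(2)]
  consider "(g, x) \<in> r" | "(x, g) \<in> r"
    using o(1,4) x(1) g by (metis refl_onD total_on_def)
  then show ?case
  proof cases
    case 1
    then show ?thesis using x by auto
  next
    case 2
    then have "\<forall>f \<in> insert g F. (f, g) \<in> r"
      using x(2) o(1,2) g by (auto dest: refl_onD transD)
    then show ?thesis using g by blast
  qed
qed

lemma positive_or_inv_positive:
  assumes "group G" "left_order G r" "g \<in> carrier G" "g \<noteq> \<one>\<^bsub>G\<^esub>"
  shows "g \<in> positive_cone G r \<or> inv\<^bsub>G\<^esub> g \<in> positive_cone G r"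
proof -
  interpret group G by (fact assms(1))
  note o = left_orderD[OF assms(2)]
  have "(\<one>\<^bsub>G\<^esub>, g) \<in> r \<or> (g, \<one>\<^bsub>G\<^esub>) \<in> r"
    using o(4) assms(3,4) by (metis one_closed total_on_def)
  moreover have "(\<one>\<^bsub>G\<^esub>, inv\<^bsub>G\<^esub> g) \<in> r" if "(g, \<one>\<^bsub>G\<^esub>) \<in> r"
    using o(5)[of g "\<one>\<^bsub>G\<^esub>" "inv\<^bsub>G\<^esub> g"] that assms(3) by simp
  ultimately show ?thesis
    using assms(3,4) by (auto simp: positive_cone_def inv_eq_1_iff)
qed

lemma left_order_nontrivial_upper_bound:
  assumes "group G" "left_order G r" "finite F" "F \<subseteq> carrier G"
    and "g \<in> carrier G" "g \<noteq> \<one>\<^bsub>G\<^esub>"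
  shows "\<exists>x \<in> carrier G. x \<noteq> \<one>\<^bsub>G\<^esub> \<and> (\<forall>f \<in> F. (f, x) \<in> r)"
proof -
  interpret group G by (fact assms(1))
  obtain p where p: "p \<in> positive_cone G r"
    using positive_or_inv_positive[OF assms(1,2,5,6)] by blast
  then have pc: "p \<in> carrier G" "(\<one>\<^bsub>G\<^esub>, p) \<in> r" "p \<noteq> \<one>\<^bsub>G\<^esub>"
    by (auto simp: positive_cone_def)
  obtain x where x: "x \<in> carrier G" "\<forall>f \<in> insert p F. (f, x) \<in> r"
    using left_order_finite_upper_bound[OF assms(1,2), of "insert p F"] assms(3,4) pc(1) by auto
  have "x \<noteq> \<one>\<^bsub>G\<^esub>"
    using x(2) pc(2,3) left_orderD(3)[OF assms(2)] by (auto dest: antisymD)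
  then show ?thesis using x by auto
qed

section \<open>Completing prefixes in a regular language\<close>

text \<open>Which words complete \<open>u\<close> to an element of \<open>L\<close> depends only on the state reached by \<open>u\<close>, so
  one completion for each state is enough, if it has any.\<close>

lemma regular_finite_completions:
  assumes "regular_language X L"
  shows "\<exists>W. finite W \<and> W \<subseteq> lists X \<and> (\<forall>u v. u @ v \<in> L \<longrightarrow> (\<exists>w \<in> W. u @ w \<in> L))"
proof -
  obtain M :: "(nat, 'a) fsa" where M: "finite_automaton X M" "accepted_language X M = L"
    using assms by (auto simp: regular_language_def)
  define ok where "ok q w \<longleftrightarrow> w \<in> lists X \<and> foldl (trans M) q w \<in> final M" for q w
  define W where "W = (\<lambda>q. SOME w. ok q w) ` {q \<in> states M. \<exists>w. ok q w}"
  have ok: "ok q (SOME w. ok q w)" if "ok q w" for q w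
    using that by (rule someI)
  have st: "foldl (trans M) q u \<in> states M" if "q \<in> states M" "u \<in> lists X" for q u
    using that(2,1) M(1) by (induction u arbitrary: q) (auto simp: finite_automaton_def)
  have "finite W"
    using M(1) by (auto simp: W_def finite_automaton_def)
  moreover have "W \<subseteq> lists X"
    using ok by (auto simp: W_def ok_def)
  moreover have "\<exists>w \<in> W. u @ w \<in> L" if "u @ v \<in> L" for u v
  proof -
    define q where "q = foldl (trans M) (init M) u"
    have u: "u \<in> lists X" and v: "ok q v"
      using that M(2) by (auto simp: accepted_language_def ok_def q_def)
    have "q \<in> states M"
      using st[OF _ u] M(1) by (auto simp: q_def finite_automaton_def)
    then have "(SOME w. ok q w) \<in> W"
      using v by (auto simp: W_def)
    moreover have "u @ (SOME w. ok q w) \<in> L"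
      using ok[OF v] u M(2) by (auto simp: accepted_language_def ok_def q_def)
    ultimately show ?thesis by blast
  qed
  ultimately show ?thesis by blast
qed

section \<open>Paths in a free product\<close>

lemma reduced_words_append:
  "u @ v \<in> reduced_words A B \<longleftrightarrow> u \<in> reduced_words A B \<and> v \<in> reduced_words A B \<and>
     (u = [] \<or> v = [] \<or> isl (last u) \<noteq> isl (hd v))"
  by (auto simp: reduced_words_def distinct_adj_append_iff last_map hd_map)

text \<open>Multiplying by a letter on the left changes at most the first letter of a word. Hence the words
  ending in \<open>k\<close> form a branch of the tree-like Cayley graph that can be entered only at \<open>k\<close>.\<close>

lemma suffix_fp_cons:
  assumes "suffix k (fp_cons A B s v)" "\<not> suffix k v"
  shows "fp_cons A B s v = k"
  using assms
  by (cases "(A, B, s, v)" rule: fp_cons.cases)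
     (auto simp: fp_left_def fp_right_def suffix_Cons split: if_splits)

lemma suffix_foldr_fp_cons:
  assumes "suffix k (foldr (fp_cons A B) s v)" "\<not> suffix k v"
  shows "\<exists>s1 s2. s = s1 @ s2 \<and> foldr (fp_cons A B) s2 v = k"
  using assms(1)
proof (induction s)
  case Nil
  then show ?case using assms(2) by simp
next
  case (Cons t s)
  show ?case
  proof (cases "suffix k (foldr (fp_cons A B) s v)")
    case True
    then show ?thesis using Cons.IH by (metis append_Cons)
  next
    case False
    then have "foldr (fp_cons A B) (t # s) v = k"
      using suffix_fp_cons[of k A B t "foldr (fp_cons A B) s v"] Cons.prems by simp
    then show ?thesis by (metis append_Nil)
  qed
qed

context
  fixes A :: "('a, 'm) monoid_scheme" and B :: "('b, 'n) monoid_scheme"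
  assumes A: "group A" and B: "group B"
begin

interpretation A: group A by (fact A)
interpretation B: group B by (fact B)
interpretation G: group "free_product A B" by (rule group_free_product[OF A B])

lemma free_product_mult_append:
  assumes "u @ v \<in> reduced_words A B"
  shows "u \<otimes>\<^bsub>free_product A B\<^esub> v = u @ v"
proof -
  have "v \<in> reduced_words A B"
    using assms by (simp add: reduced_words_append)
  then show ?thesis
    using foldr_fp_cons_Nil[OF A B assms] foldr_fp_cons_Nil[OF A B, of v]
    by (simp add: free_product_def)
qed

text \<open>If the last letter of \<open>inv x\<close> and the letter \<open>s\<close> belonged to the same factor, there would be
  no cancellation in the product of \<open>inv x\<close> and \<open>x\<close> either.\<close>

lemma reduced_conjugate:
  assumes "s # x \<in> reduced_words A B" "x \<noteq> []"
  shows "inv\<^bsub>free_product A B\<^esub> x @ s # x \<in> reduced_words A B"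
proof -
  let ?h = "inv\<^bsub>free_product A B\<^esub> x"
  have sx: "x \<in> reduced_words A B" "isl s \<noteq> isl (hd x)"
    using assms reduced_words_append[of "[s]" x A B] by auto
  then have x: "x \<in> carrier (free_product A B)" by (simp add: free_product_def)
  have h: "?h \<in> reduced_words A B"
    using G.inv_closed[OF x] by (simp add: free_product_def)
  have "?h \<otimes>\<^bsub>free_product A B\<^esub> x = []"
    using G.l_inv[OF x] by (simp add: free_product_def)
  then have "?h @ x \<notin> reduced_words A B"
    using free_product_mult_append[of ?h x] assms(2) by auto
  then have "?h \<noteq> []" "isl (last ?h) = isl (hd x)"
    using h sx by (auto simp: reduced_words_append)
  then show ?thesis
    using h assms(1) sx(2) by (auto simp: reduced_words_append)
qed

text \<open>Two mutually inverse letters are provided because an order decides only up to inversion which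
  conjugate is positive.\<close>

lemma opposite_letter:
  assumes "\<not> trivial_group A" "\<not> trivial_group B" "x \<in> reduced_words A B" "x \<noteq> []"
  obtains s t where "s # x \<in> reduced_words A B" "t # x \<in> reduced_words A B"
    "[t] = inv\<^bsub>free_product A B\<^esub> [s]"
proof -
  have inv_eq: "v = inv\<^bsub>free_product A B\<^esub> u"
    if "u \<in> reduced_words A B" "v \<in> reduced_words A B" "foldr (fp_cons A B) v u = []" for u v
    using G.inv_equality[of v u] that by (simp add: free_product_def)
  show ?thesis
  proof (cases "hd x")
    case (Inl a)
    obtain b where b: "b \<in> carrier B" "b \<noteq> \<one>\<^bsub>B\<^esub>"
      using assms(2) B.is_group by (auto simp: trivial_group_def)
    have "Inr b # x \<in> reduced_words A B" "Inr (inv\<^bsub>B\<^esub> b) # x \<in> reduced_words A B"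
      using b assms(3,4) Inl
      by (auto simp: reduced_words_Inr[OF A B] B.inv_eq_1_iff)
    moreover have "[Inr (inv\<^bsub>B\<^esub> b)] = inv\<^bsub>free_product A B\<^esub> [Inr b]"
      using b
      by (intro inv_eq) (auto simp: reduced_words_Inr[OF A B] reduced_words_Nil[OF A B]
          fp_right_def B.inv_eq_1_iff)
    ultimately show ?thesis by (rule that)
  next
    case (Inr b)
    obtain a where a: "a \<in> carrier A" "a \<noteq> \<one>\<^bsub>A\<^esub>"
      using assms(1) A.is_group by (auto simp: trivial_group_def)
    have "Inl a # x \<in> reduced_words A B" "Inl (inv\<^bsub>A\<^esub> a) # x \<in> reduced_words A B"
      using a assms(3,4) Inr
      by (auto simp: reduced_words_Inl[OF A B] A.inv_eq_1_iff)
    moreover have "[Inl (inv\<^bsub>A\<^esub> a)] = inv\<^bsub>free_product A B\<^esub> [Inl a]"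
      using a
      by (intro inv_eq) (auto simp: reduced_words_Inl[OF A B] reduced_words_Nil[OF A B]
          fp_left_def A.inv_eq_1_iff)
    ultimately show ?thesis by (rule that)
  qed
qed

text \<open>For given \<open>x\<close>, one of two mutually inverse conjugates is positive, and both have a reduced
  form in which \<open>inv x\<close> is visible as a prefix.\<close>

lemma positive_reduced_conjugate:
  assumes "\<not> trivial_group A" "\<not> trivial_group B" "left_order (free_product A B) r"
    and "x \<in> reduced_words A B" "x \<noteq> []"
  obtains s where "s # x \<in> reduced_words A B"
    "inv\<^bsub>free_product A B\<^esub> x @ s # x \<in> positive_cone (free_product A B) r"
proof -
  let ?G = "free_product A B"
  obtain s t where st: "s # x \<in> reduced_words A B" "t # x \<in> reduced_words A B"
    "[t] = inv\<^bsub>?G\<^esub> [s]"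
    using opposite_letter[OF assms(1,2,4,5)] by blast
  have x: "x \<in> carrier ?G" using assms(4) by (simp add: free_product_def)
  have letter: "[y] \<in> carrier ?G" if "y # x \<in> reduced_words A B" for y
    using that reduced_words_append[of "[y]" x A B] by (simp add: free_product_def)
  have conj: "inv\<^bsub>?G\<^esub> x @ y # x = inv\<^bsub>?G\<^esub> x \<otimes>\<^bsub>?G\<^esub> ([y] \<otimes>\<^bsub>?G\<^esub> x)"
    if "y # x \<in> reduced_words A B" for y
    using free_product_mult_append[of "[y]" x] that
      free_product_mult_append[OF reduced_conjugate[OF that assms(5)]] by simp
  have "inv\<^bsub>?G\<^esub> (inv\<^bsub>?G\<^esub> x @ s # x) = inv\<^bsub>?G\<^esub> x @ t # x"
    using x letter[OF st(1)] by (simp add: conj st(1,2) st(3) G.inv_mult_group G.m_assoc)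
  moreover have "inv\<^bsub>?G\<^esub> x @ s # x \<in> carrier ?G" "inv\<^bsub>?G\<^esub> x @ s # x \<noteq> \<one>\<^bsub>?G\<^esub>"
    using reduced_conjugate[OF st(1) assms(5)] by (auto simp: free_product_def)
  ultimately show ?thesis
    using positive_or_inv_positive[OF G.is_group assms(3)] that st(1,2) by metis
qed

text \<open>Read from its end, a word evaluating to \<open>h @ k\<close> must at some moment enter the branch of the
  elements ending in \<open>k\<close>. This happens at \<open>k\<close> itself, possibly in the middle of the image \<open>s @ s'\<close>
  of a letter, and what has not been read by then evaluates to \<open>h\<close>.\<close>

lemma word_passes_through_prefix:
  assumes hom: "\<phi> \<in> hom (free_monoid X) (free_product A B)"
    and one: "\<phi> [] = []"
    and w: "w \<in> lists X" "\<phi> w = h @ k" and k: "k \<noteq> []"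
  shows "\<exists>u v y s s'. w = u @ v \<and> y \<in> X \<and> \<phi> [y] = s @ s' \<and>
           \<phi> u \<otimes>\<^bsub>free_product A B\<^esub> s = h"
proof -
  let ?G = "free_product A B"
  have mult: "\<phi> (u @ v) = \<phi> u \<otimes>\<^bsub>?G\<^esub> \<phi> v" if "u \<in> lists X" "v \<in> lists X" for u v
    using hom_mult[OF hom] that by (simp add: free_monoid_def)
  have closed: "\<phi> u \<in> reduced_words A B" if "u \<in> lists X" for u
    using hom_in_carrier[OF hom] that by (simp add: free_monoid_def free_product_def)
  have enter: "\<exists>u y z s s'. w = u @ y # z \<and> \<phi> [y] = s @ s' \<and> s' \<otimes>\<^bsub>?G\<^esub> \<phi> z = k"
    if "w \<in> lists X" "suffix k (\<phi> w)" for w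
    using that
  proof (induction w rule: list.induct)
    case Nil
    then show ?case using one k by simp
  next
    case (Cons y w)
    show ?case
    proof (cases "suffix k (\<phi> w)")
      case True
      then show ?thesis using Cons.IH Cons.prems(1) by (metis Cons_in_lists_iff append_Cons)
    next
      case False
      have "\<phi> (y # w) = foldr (fp_cons A B) (\<phi> [y]) (\<phi> w)"
        using mult[of "[y]" w] Cons.prems(1) by (simp add: free_product_def)
      then obtain s s' where "\<phi> [y] = s @ s'" "foldr (fp_cons A B) s' (\<phi> w) = k"
        using suffix_foldr_fp_cons[OF _ False] Cons.prems(2) by metis
      then have "y # w = [] @ y # w \<and> \<phi> [y] = s @ s' \<and> s' \<otimes>\<^bsub>?G\<^esub> \<phi> w = k"
        by (simp add: free_product_def)
      then show ?thesis by blast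
    qed
  qed
  obtain u y z s s' where d: "w = u @ y # z" "\<phi> [y] = s @ s'" "s' \<otimes>\<^bsub>?G\<^esub> \<phi> z = k"
    using enter[OF w(1)] w(2) by (auto simp: suffix_def)
  have X: "u \<in> lists X" "y \<in> X" "z \<in> lists X" using w(1) d(1) by auto
  have red: "s @ s' \<in> reduced_words A B" "h @ k \<in> reduced_words A B"
    using closed[of "[y]"] closed[OF w(1)] X(2) d(2) w(2) by auto
  then have c: "s \<in> carrier ?G" "s' \<in> carrier ?G" "h \<in> carrier ?G" "k \<in> carrier ?G"
    "\<phi> u \<in> carrier ?G" "\<phi> z \<in> carrier ?G"
    using closed X by (auto simp: reduced_words_append free_product_def)
  have "h \<otimes>\<^bsub>?G\<^esub> k = \<phi> (u @ [y] @ z)"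
    using free_product_mult_append[OF red(2)] w(2) d(1) by simp
  also have "\<dots> = \<phi> u \<otimes>\<^bsub>?G\<^esub> ((s \<otimes>\<^bsub>?G\<^esub> s') \<otimes>\<^bsub>?G\<^esub> \<phi> z)"
    using mult[of u "[y] @ z"] mult[of "[y]" z] X d(2) free_product_mult_append[OF red(1)] by simp
  also have "\<dots> = (\<phi> u \<otimes>\<^bsub>?G\<^esub> s) \<otimes>\<^bsub>?G\<^esub> k"
    using c d(3) by (simp add: G.m_assoc)
  finally have "\<phi> u \<otimes>\<^bsub>?G\<^esub> s = h"
    using c by simp
  then show ?thesis using d X by blast
qed

text \<open>A word for \<open>h @ k\<close> has a prefix \<open>u\<close> whose value differs from \<open>h\<close> only by an initial piece \<open>s\<close> of
  the image of a letter. Undoing \<open>s\<close> and then completing \<open>u\<close> leads from \<open>h\<close> back into \<open>P\<close>, and there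
  are finitely many choices for both.\<close>

lemma regular_finite_test_set:
  assumes "finite X"
    and hom: "\<phi> \<in> hom (free_monoid X) (free_product A B)"
    and one: "\<phi> [] = []"
    and L: "L \<subseteq> lists X" "\<phi> ` L = P"
    and reg: "regular_language X L"
  obtains F where "finite F" "F \<subseteq> carrier (free_product A B)"
    "\<And>h k. h @ k \<in> P \<Longrightarrow> k \<noteq> [] \<Longrightarrow>
      \<exists>f \<in> F. h \<otimes>\<^bsub>free_product A B\<^esub> f \<in> P"
proof -
  let ?G = "free_product A B"
  obtain W where W: "finite W" "W \<subseteq> lists X"
    "\<And>u v. u @ v \<in> L \<Longrightarrow> \<exists>w \<in> W. u @ w \<in> L"
    using regular_finite_completions[OF reg] by blast
  have closed: "\<phi> u \<in> carrier ?G" if "u \<in> lists X" for u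
    using hom_in_carrier[OF hom] that by (simp add: free_monoid_def)
  define V where "V = (\<Union>y \<in> X. {s. prefix s (\<phi> [y])})"
  have "finite V"
    using \<open>finite X\<close> by (auto simp: V_def simp flip: set_prefixes_eq)
  have V: "V \<subseteq> carrier ?G"
  proof
    fix s assume "s \<in> V"
    then obtain y s' where "y \<in> X" "\<phi> [y] = s @ s'" by (auto simp: V_def prefix_def)
    then show "s \<in> carrier ?G"
      using closed[of "[y]"] by (simp add: free_product_def reduced_words_append)
  qed
  define F where "F = (\<lambda>(s, w). inv\<^bsub>?G\<^esub> s \<otimes>\<^bsub>?G\<^esub> \<phi> w) ` (V \<times> W)"
  have "finite F" using \<open>finite V\<close> W(1) by (simp add: F_def)
  moreover have "F \<subseteq> carrier ?G" using V W(2) closed by (fastforce simp: F_def)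
  moreover have "\<exists>f \<in> F. h \<otimes>\<^bsub>?G\<^esub> f \<in> P"
    if hk: "h @ k \<in> P" "k \<noteq> []" for h k
  proof -
    obtain w where w: "w \<in> L" "\<phi> w = h @ k" using hk(1) L(2) by force
    obtain u v y s s' where u: "w = u @ v" "y \<in> X" "\<phi> [y] = s @ s'" "\<phi> u \<otimes>\<^bsub>?G\<^esub> s = h"
      using word_passes_through_prefix[OF hom one _ w(2) hk(2)] w(1) L(1) by blast
    obtain w' where w': "w' \<in> W" "u @ w' \<in> L" using W(3) w(1) u(1) by blast
    have X: "u \<in> lists X" "w' \<in> lists X" using w' L(1) by auto
    have "s \<in> V" using u(2,3) by (force simp: V_def)
    then have "s \<in> carrier ?G" using V by auto
    then have "h \<otimes>\<^bsub>?G\<^esub> (inv\<^bsub>?G\<^esub> s \<otimes>\<^bsub>?G\<^esub> \<phi> w') = \<phi> u \<otimes>\<^bsub>?G\<^esub> \<phi> w'"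
      using closed[OF X(1)] closed[OF X(2)] u(4)
      by (metis G.inv_solve_right G.inv_closed G.m_assoc G.m_closed)
    also have "\<dots> = \<phi> (u @ w')"
      using hom_mult[OF hom, of u w'] X by (simp add: free_monoid_def)
    also have "\<dots> \<in> P" using w'(2) L(2) by auto
    finally show ?thesis
      using \<open>s \<in> V\<close> w'(1) by (auto simp: F_def)
  qed
  ultimately show ?thesis by (rule that)
qed

end

section \<open>Positive cones of free products are not regular\<close>

theorem theorem1:
  fixes A :: "('a, 'm) monoid_scheme" and B :: "('b, 'n) monoid_scheme"
    and r :: "('a + 'b) list rel"
    and X :: "'x set" and \<phi> :: "'x list \<Rightarrow> ('a + 'b) list" and L :: "'x list set"
  assumes "group A" and "\<not> trivial_group A" and "finitely_generated A" and "orderable A"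
    and "group B" and "\<not> trivial_group B" and "finitely_generated B" and "orderable B"
    and "left_order (free_product A B) r"
    and "finite X"
    and "\<phi> \<in> hom (free_monoid X) (free_product A B)"
    and "\<phi> \<one>\<^bsub>free_monoid X\<^esub> = \<one>\<^bsub>free_product A B\<^esub>"
    and "L \<subseteq> carrier (free_monoid X)"
    and "\<phi> ` L = positive_cone (free_product A B) r"
  shows "\<not> regular_language X L"
proof
  assume reg: "regular_language X L"
  let ?G = "free_product A B"
  note AB = \<open>group A\<close> \<open>group B\<close>
  interpret G: group ?G by (rule group_free_product[OF AB])
  have "\<phi> [] = []" "L \<subseteq> lists X"
    using assms(12,13) by (auto simp: free_monoid_def free_product_def)
  then obtain F where F: "finite F" "F \<subseteq> carrier ?G"
    "\<And>h k. h @ k \<in> positive_cone ?G r \<Longrightarrow> k \<noteq> [] \<Longrightarrow>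
      \<exists>f \<in> F. h \<otimes>\<^bsub>?G\<^esub> f \<in> positive_cone ?G r"
    using regular_finite_test_set[OF AB assms(10,11) _ _ assms(14) reg] by blast
  obtain a where a: "a \<in> carrier A" "a \<noteq> \<one>\<^bsub>A\<^esub>"
    using assms(1,2) by (auto simp: trivial_group_def group.is_monoid)
  then have "[Inl a] \<in> carrier ?G" "[Inl a] \<noteq> \<one>\<^bsub>?G\<^esub>"
    by (auto simp: free_product_def reduced_words_Inl[OF AB] reduced_words_Nil[OF AB])
  then obtain x where x: "x \<in> carrier ?G" "x \<noteq> \<one>\<^bsub>?G\<^esub>" "\<forall>f \<in> F. (f, x) \<in> r"
    using left_order_nontrivial_upper_bound[OF G.is_group assms(9) F(1,2)] by blast
  then have "x \<in> reduced_words A B" "x \<noteq> []"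
    by (simp_all add: free_product_def)
  \<comment> \<open>A positive element having \<open>inv x\<close> as a prefix forces \<open>x < f\<close> for some \<open>f \<in> F\<close>.\<close>
  then obtain s where "inv\<^bsub>?G\<^esub> x @ s # x \<in> positive_cone ?G r"
    using positive_reduced_conjugate[OF AB assms(2,6,9)] by blast
  then obtain f where f: "f \<in> F" "inv\<^bsub>?G\<^esub> x \<otimes>\<^bsub>?G\<^esub> f \<in> positive_cone ?G r"
    using F(3) by blast
  have "(inv\<^bsub>?G\<^esub> x \<otimes>\<^bsub>?G\<^esub> f, \<one>\<^bsub>?G\<^esub>) \<in> r"
    using left_orderD(5)[OF assms(9), of f x "inv\<^bsub>?G\<^esub> x"] x f(1) F(2) by auto
  then show False
    using f(2) left_orderD(3)[OF assms(9)] by (auto simp: positive_cone_def dest: antisymD)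
qed

end
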